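(* Let $|z|<1$, $n\in\mathbb{N}_0$, and let the parameters of each function below satisfy the conditions in the definition of the extended Gauss hypergeometric function. The following recurrence relations hold true. 1. (Recurrence relations for ${}_2F_1^{(\kappa_l)}(\alpha_1\pm n,\alpha_2;\beta_1;z;b,d)$) $$ {}_{2}F_{1}^{(\kappa_l)}\left[\begin{array}{c}\alpha_1+n,\alpha_2\\ \beta_1\end{array};z;b,d\right]={}_{2}F_{1}^{(\kappa_l)}\left[\begin{array}{c}\alpha_1,\alpha_2\\ \beta_1\end{array};z;b,d\right]+\frac{\alpha_2z}{\beta_1}\sum_{k=1}^n{}_{2}F_{1}^{(\kappa_l)}\left[\begin{array}{c}\alpha_1+n-k+1,\alpha_2+1\\ \beta_1+1\end{array};z;b,d\right], $$ $$ {}_{2}F_{1}^{(\kappa_l)}\left[\begin{array}{c}\alpha_1-n,\alpha_2\\ \beta_1\end{array};z;b,d\right]={}_{2}F_{1}^{(\kappa_l)}\left[\begin{array}{c}\alpha_1,\alpha_2\\ \beta_1\end{array};z;b,d\right]-\frac{\alpha_2z}{\beta_1}\sum_{k=1}^n{}_{2}F_{1}^{(\kappa_l)}\left[\begin{array}{c}\alpha_1-k+1,\alpha_2+1\\ \beta_1+1\end{array};z;b,d\right]. $$ 2. (Recurrence relation for ${}_2F_1^{(\kappa_l)}(\alpha_1,\alpha_2;\beta_1+n;z;b,d)$) $$ {}_{2}F_{1}^{(\kappa_l)}\left[\begin{array}{c}\alpha_1,\alpha_2\\ \beta_1+n\end{array};z;b,d\right]=\frac{(\beta_1)_n}{(\beta_1-\alpha_2)_n}\sum_{k=0}^n(-1)^k\binom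 nk\frac{(\alpha_2)_k}{(\beta_1)_k}\,{}_{2}F_{1}^{(\kappa_l)}\left[\begin{array}{c}\alpha_1,\alpha_2+k\\ \beta_1+k\end{array};z;b,d\right]. $$ 3. (Recurrence relation for ${}_2F_1^{(\kappa_l)}(\alpha_1,\alpha_2+n;\beta_1;z;b,d)$) $$ {}_{2}F_{1}^{(\kappa_l)}\left[\begin{array}{c}\alpha_1,\alpha_2+n\\ \beta_1\end{array};z;b,d\right]=\frac{(\beta_1-\alpha_2)_{2n}}{(\beta_1-\alpha_2)_n(\alpha_2)_n}\sum_{i=1}^n(-n)_i\frac{(\alpha_2)_{i+n}}{(\beta_1)_{i+n}\,i!}\,{}_{2}F_{1}^{(\kappa_l)}\left[\begin{array}{c}\alpha_1,\alpha_2+i+n\\ \beta_1+i+n\end{array};z;b,d\right]. $$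
   Context: Here $(a)_m=\Gamma(a+m)/\Gamma(a)$ is the Pochhammer symbol and $B(\cdot,\cdot)$ is Euler's beta function. Let $\Theta(\kappa_l;z)$ be a function analytic in a disk $|z|<R$ ($0<R<\infty$), with $\Theta(\kappa_l;z)=\sum_{l\ge0}\kappa_l z^l/l!$ there ($\kappa_0=1$), which can be continued analytically in the right half-plane $\Re(z)>0$ with $\Theta(\kappa_l;z)=M_0z^{\omega}e^{z}[1+O(1/z)]$ as $\Re(z)\to\infty$, for suitable constants $M_0>0$, $\omega\in\mathbb{C}$ depending on the sequence $\{\kappa_l\}$. For $\min\{\Re(\alpha),\Re(\beta)\}>0$ and $\min\{\Re(b),\Re(d)\}\ge0$, $$\mathcal{B}^{(\kappa_l)}_{b,d}(\alpha,\beta)=\int_0^1t^{\alpha-1}(1-t)^{\beta-1}\Theta\left(\kappa_l;-\frac bt-\frac d{1-t}\right)dt .$$ The extended Gauss hypergeometric function is, for $|z|<1$, $\Re(\beta_1)>\Re(\alpha_2)>0$ and $\min\{\Re(b),\Re(d)\}\ge0$, $${}_{2}F_{1}^{(\kappa_l)}\left[\begin{array}{c}\alpha_1,\alpha_2\\ \beta_1\end{array};z;b,d\right]=\sum_{n=0}^\infty(\alpha_1)_n\frac{\mathcal{B}^{(\kappa_l)}_{b,d}(\alpha_2+n,\beta_1-\alpha_2)}{B(\alpha_2,\beta_1-\alpha_2)}\frac{z^n}{n!}.$$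
   Formalization: Part 3 as printed is false; proved with β₁+2n for β₁ on the left, (β₁)_{2n} for (β₁−α₂)_{2n}, sum from i=0, conditions also at i=0, and α₂, β₁ not in {0,−1,−2,…}; throughout, the defining beta integrals are assumed absolutely convergent. *)

theory Defs
  imports "HOL-Analysis.Analysis" "HOL-Library.Landau_Symbols"
begin

text \<open>
  The kernel is a total function on the complex plane; only its behaviour on the disk and on the
  right half-plane is prescribed. The beta-type integral below evaluates it at points of
  nonpositive real part, about which the asymptotic condition says nothing; the convergence of
  that integral is therefore a condition of its own, \<open>ext_beta_converges\<close>.
  The power \<open>z powr \<omega>\<close> is the principal branch, and the limit \<open>Re z \<rightarrow> \<infinity>\<close> is uniform in \<open>Im z\<close>.
\<close>

definition is_kernel ::
  "(nat \<Rightarrow> complex) \<Rightarrow> real \<Rightarrow> real \<Rightarrow> complex \<Rightarrow> (complex \<Rightarrow> complex) \<Rightarrow> bool" where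
  "is_kernel \<kappa> R M\<^sub>0 \<omega> \<Theta> \<longleftrightarrow>
     0 < R \<and> \<kappa> 0 = 1 \<and>
     (\<forall>z. norm z < R \<longrightarrow> (\<lambda>l. \<kappa> l * z ^ l / fact l) sums \<Theta> z) \<and>
     \<Theta> holomorphic_on (ball 0 R \<union> {z. 0 < Re z}) \<and>
     0 < M\<^sub>0 \<and>
     (\<lambda>z. \<Theta> z / (of_real M\<^sub>0 * z powr \<omega> * exp z) - 1)
        \<in> O[filtercomap Re at_top](\<lambda>z. 1 / z)"

definition ext_beta_integrand ::
  "(complex \<Rightarrow> complex) \<Rightarrow> complex \<Rightarrow> complex \<Rightarrow> complex \<Rightarrow> complex \<Rightarrow> real \<Rightarrow> complex" where
  "ext_beta_integrand \<Theta> b d \<alpha> \<beta> t =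
     of_real t powr (\<alpha> - 1) * of_real (1 - t) powr (\<beta> - 1) *
     \<Theta> (- (b / of_real t) - d / of_real (1 - t))"

definition ext_beta ::
  "(complex \<Rightarrow> complex) \<Rightarrow> complex \<Rightarrow> complex \<Rightarrow> complex \<Rightarrow> complex \<Rightarrow> complex" where
  "ext_beta \<Theta> b d \<alpha> \<beta> =
     set_lebesgue_integral lborel {0<..<1} (ext_beta_integrand \<Theta> b d \<alpha> \<beta>)"

definition ext_beta_converges ::
  "(complex \<Rightarrow> complex) \<Rightarrow> complex \<Rightarrow> complex \<Rightarrow> complex \<Rightarrow> complex \<Rightarrow> bool" where
  "ext_beta_converges \<Theta> b d \<alpha> \<beta> \<longleftrightarrow>
     set_integrable lborel {0<..<1} (ext_beta_integrand \<Theta> b d \<alpha> \<beta>)"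

definition ext_2F1 ::
  "(complex \<Rightarrow> complex) \<Rightarrow> complex \<Rightarrow> complex \<Rightarrow> complex \<Rightarrow> complex \<Rightarrow> complex \<Rightarrow> complex \<Rightarrow> complex"
where
  "ext_2F1 \<Theta> \<alpha>\<^sub>1 \<alpha>\<^sub>2 \<beta>\<^sub>1 z b d =
     (\<Sum>m. pochhammer \<alpha>\<^sub>1 m *
        (ext_beta \<Theta> b d (\<alpha>\<^sub>2 + of_nat m) (\<beta>\<^sub>1 - \<alpha>\<^sub>2) / Beta \<alpha>\<^sub>2 (\<beta>\<^sub>1 - \<alpha>\<^sub>2)) *
        (z ^ m / fact m))"

text \<open>
  Convergence is required only of the integral in the term \<open>m = 0\<close>. As \<open>0 < t ^ m \<le> 1\<close> on the
  interval of integration, the integrals of all later terms then converge too and are bounded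
  in \<open>m\<close>, so that the series converges for every \<open>\<alpha>\<^sub>1\<close> and \<open>norm z < 1\<close>.
\<close>

definition ext_2F1_conditions ::
  "(complex \<Rightarrow> complex) \<Rightarrow> complex \<Rightarrow> complex \<Rightarrow> complex \<Rightarrow> complex \<Rightarrow> complex \<Rightarrow> bool" where
  "ext_2F1_conditions \<Theta> \<alpha>\<^sub>2 \<beta>\<^sub>1 z b d \<longleftrightarrow>
     norm z < 1 \<and> Re \<beta>\<^sub>1 > Re \<alpha>\<^sub>2 \<and> Re \<alpha>\<^sub>2 > 0 \<and> min (Re b) (Re d) \<ge> 0 \<and>
     ext_beta_converges \<Theta> b d \<alpha>\<^sub>2 (\<beta>\<^sub>1 - \<alpha>\<^sub>2)"

end

theory Submission
  imports Defs
begin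

text \<open>
  On the unit interval, raising the exponents of the integrand by natural numbers \<open>m\<close> and \<open>n\<close>
  multiplies it by the bounded factor \<open>t ^ m * (1 - t) ^ n\<close>, so integrability persists and the
  coefficients of the series stay bounded. The recurrences in \<open>\<alpha>\<^sub>1\<close> telescope from
  \<open>(a + 1)\<^sub>m - (a)\<^sub>m = m (a + 1)\<^sub>m\<^sub>-\<^sub>1\<close>. The one in \<open>\<beta>\<^sub>1\<close> is the binomial expansion of
  \<open>(1 - t) ^ n\<close> under the integral, and the last one is its instance at
  \<open>(\<alpha>\<^sub>2 + n, \<beta>\<^sub>1 + n)\<close>.
\<close>

section \<open>The extended beta integral under natural shifts of its exponents\<close>

lemma ext_beta_integrand_add_nat:
  assumes "0 < t" "t < 1"
  shows "ext_beta_integrand \<Theta> b d (\<alpha> + of_nat m) (\<beta> + of_nat n) t =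
           of_real (t ^ m * (1 - t) ^ n) * ext_beta_integrand \<Theta> b d \<alpha> \<beta> t"
proof -
  have *: "of_real s powr (x + of_nat k - 1) = of_real (s ^ k) * of_real s powr (x - 1)"
    if "0 < s" for s :: real and x :: complex and k :: nat
  proof -
    have "of_real s powr (x + of_nat k - 1) = of_real s powr ((x - 1) + of_nat k)"
      by (simp add: algebra_simps)
    also have "\<dots> = of_real s powr (x - 1) * of_real s powr of_nat k"
      using that by (simp add: powr_add)
    \<comment> \<open>Positivity of \<open>s\<close> rules out the default
      \<open>0 powr 0 = 0\<close>, which would disagree with \<open>0 ^ 0 = 1\<close>.\<close>
    also have "of_real s powr (of_nat k :: complex) = of_real (s ^ k)"
      using that by (simp add: powr_nat')
    finally show ?thesis
      by simp
  qed
  show ?thesis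
    unfolding ext_beta_integrand_def using assms
    by (subst (1 2) *) (simp_all add: mult_ac)
qed

text \<open>The weight lies between 0 and 1 on the interval, so the original integrand dominates the
  weighted one.\<close>

lemma set_integrable_ext_beta_integrand_factor:
  assumes "ext_beta_converges \<Theta> b d \<alpha> \<beta>"
  shows "set_integrable lborel {0<..<1}
           (\<lambda>t. of_real (t ^ m * (1 - t) ^ n) * ext_beta_integrand \<Theta> b d \<alpha> \<beta> t)"
proof (rule set_integrable_bound)
  show int: "set_integrable lborel {0<..<1} (ext_beta_integrand \<Theta> b d \<alpha> \<beta>)"
    using assms by (simp add: ext_beta_converges_def)
  \<comment> \<open>Measurability is available only after cutting off to the interval, where
    integrability supplies it; multiplying by the polynomial weight preserves it.\<close>
  have "(\<lambda>t. indicator {0<..<1} t *\<^sub>R ext_beta_integrand \<Theta> b d \<alpha> \<beta> t) \<in> borel_measurable lborel"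
    using int unfolding set_integrable_def by (rule borel_measurable_integrable)
  then have "(\<lambda>t. of_real (t ^ m * (1 - t) ^ n) *
      (indicator {0<..<1} t *\<^sub>R ext_beta_integrand \<Theta> b d \<alpha> \<beta> t)) \<in> borel_measurable lborel"
    by (rule borel_measurable_times[rotated]) measurable
  then show "set_borel_measurable lborel {0<..<1}
      (\<lambda>t. of_real (t ^ m * (1 - t) ^ n) * ext_beta_integrand \<Theta> b d \<alpha> \<beta> t)"
    unfolding set_borel_measurable_def by simp
  have "norm (of_real (t ^ m * (1 - t) ^ n) * ext_beta_integrand \<Theta> b d \<alpha> \<beta> t)
      \<le> norm (ext_beta_integrand \<Theta> b d \<alpha> \<beta> t)" if "t \<in> {0<..<1}" for t
  proof -
    have "t ^ m * (1 - t) ^ n \<le> 1" "0 \<le> t ^ m * (1 - t) ^ n"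
      using that by (auto intro!: mult_le_one power_le_one)
    then have "norm (of_real (t ^ m * (1 - t) ^ n) :: complex) \<le> 1"
      unfolding norm_of_real by linarith
    then show ?thesis
      unfolding norm_mult by (intro mult_left_le_one_le) auto
  qed
  then show "AE t in lborel. t \<in> {0<..<1} \<longrightarrow>
      norm (of_real (t ^ m * (1 - t) ^ n) * ext_beta_integrand \<Theta> b d \<alpha> \<beta> t)
      \<le> norm (ext_beta_integrand \<Theta> b d \<alpha> \<beta> t)"
    by simp
qed

lemma ext_beta_add_nat:
  "ext_beta \<Theta> b d (\<alpha> + of_nat m) (\<beta> + of_nat n) =
     (LINT t:{0<..<1}|lborel. of_real (t ^ m * (1 - t) ^ n) * ext_beta_integrand \<Theta> b d \<alpha> \<beta> t)"
  unfolding ext_beta_def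
  by (rule set_lebesgue_integral_cong) (auto simp: ext_beta_integrand_add_nat)

lemma ext_beta_add_nat_left:
  "ext_beta \<Theta> b d (\<alpha> + of_nat m) \<beta> =
     (LINT t:{0<..<1}|lborel. of_real (t ^ m) * ext_beta_integrand \<Theta> b d \<alpha> \<beta> t)"
  using ext_beta_add_nat[of \<Theta> b d \<alpha> m \<beta> 0] by simp

lemma ext_beta_converges_add_nat:
  assumes "ext_beta_converges \<Theta> b d \<alpha> \<beta>"
  shows "ext_beta_converges \<Theta> b d (\<alpha> + of_nat m) (\<beta> + of_nat n)"
proof -
  have "set_integrable lborel {0<..<1} (ext_beta_integrand \<Theta> b d (\<alpha> + of_nat m) (\<beta> + of_nat n))
    \<longleftrightarrow> set_integrable lborel {0<..<1}
          (\<lambda>t. of_real (t ^ m * (1 - t) ^ n) * ext_beta_integrand \<Theta> b d \<alpha> \<beta> t)"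
    by (rule set_integrable_cong) (auto simp: ext_beta_integrand_add_nat)
  then show ?thesis
    using set_integrable_ext_beta_integrand_factor[OF assms]
    by (simp add: ext_beta_converges_def)
qed

text \<open>The bound does not depend on \<open>m\<close>; this uniformity reduces convergence of
  the hypergeometric series to that of a binomial series.\<close>

lemma norm_ext_beta_add_nat_le:
  assumes "ext_beta_converges \<Theta> b d \<alpha> \<beta>"
  shows "norm (ext_beta \<Theta> b d (\<alpha> + of_nat m) \<beta>) \<le>
           (LINT t:{0<..<1}|lborel. norm (ext_beta_integrand \<Theta> b d \<alpha> \<beta> t))"
proof -
  let ?f = "ext_beta_integrand \<Theta> b d \<alpha> \<beta>"
  have f: "set_integrable lborel {0<..<1} ?f"
    using assms by (simp add: ext_beta_converges_def)
  have g: "set_integrable lborel {0<..<1} (\<lambda>t. of_real (t ^ m) * ?f t)"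
    using set_integrable_ext_beta_integrand_factor[OF assms, where n = 0] by simp
  have "norm (ext_beta \<Theta> b d (\<alpha> + of_nat m) \<beta>) \<le>
      (LINT t:{0<..<1}|lborel. norm (of_real (t ^ m) * ?f t))"
    unfolding ext_beta_add_nat_left by (rule set_integral_norm_bound[OF g])
  also have "\<dots> \<le> (LINT t:{0<..<1}|lborel. norm (?f t))"
    using f g
    by (intro set_integral_mono set_integrable_norm)
       (auto simp: norm_mult norm_power intro!: mult_left_le_one_le power_le_one)
  finally show ?thesis .
qed

text \<open>Trades a shift of the second exponent for an alternating combination of shifts of the
  first, so that all terms share the same \<open>\<beta>\<close>.\<close>

lemma ext_beta_binomial:
  assumes "ext_beta_converges \<Theta> b d \<alpha> \<beta>"
  shows "ext_beta \<Theta> b d \<alpha> (\<beta> + of_nat n) =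
           (\<Sum>k=0..n. (-1) ^ k * of_nat (n choose k) * ext_beta \<Theta> b d (\<alpha> + of_nat k) \<beta>)"
proof -
  let ?f = "ext_beta_integrand \<Theta> b d \<alpha> \<beta>"
  have int: "set_integrable lborel {0<..<1}
      (\<lambda>t. (-1) ^ k * of_nat (n choose k) * (of_real (t ^ k) * ?f t))" for k
    using set_integrable_ext_beta_integrand_factor[OF assms, where n = 0 and m = k]
    by (intro set_integrable_mult_right) simp
  have expand: "of_real ((1 - t) ^ n) * ?f t =
      (\<Sum>k=0..n. (-1) ^ k * of_nat (n choose k) * (of_real (t ^ k) * ?f t))" for t
  proof -
    \<comment> \<open>With \<open>- t\<close> as the first summand, the binomial theorem attaches
      the power \<open>k\<close> to it and leaves only powers of 1 from the second.\<close>
    have "of_real ((1 - t) ^ n) = (- of_real t + 1 :: complex) ^ n"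
      by simp
    also have "\<dots> = (\<Sum>k=0..n. (-1) ^ k * of_nat (n choose k) * of_real (t ^ k))"
      by (subst binomial_ring) (simp add: atLeast0AtMost power_minus[of "of_real t"] mult_ac)
    finally show ?thesis
      by (simp only: sum_distrib_right mult.assoc)
  qed
  have "ext_beta \<Theta> b d \<alpha> (\<beta> + of_nat n) =
      (LINT t:{0<..<1}|lborel. of_real ((1 - t) ^ n) * ?f t)"
    using ext_beta_add_nat[where m = 0 and n = n] by simp
  also have "\<dots> = (\<Sum>k=0..n. LINT t:{0<..<1}|lborel.
      (-1) ^ k * of_nat (n choose k) * (of_real (t ^ k) * ?f t))"
    unfolding expand using int unfolding set_lebesgue_integral_def set_integrable_def scaleR_sum_right
    by (rule Bochner_Integration.integral_sum)
  also have "\<dots> = (\<Sum>k=0..n. (-1) ^ k * of_nat (n choose k) *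
      ext_beta \<Theta> b d (\<alpha> + of_nat k) \<beta>)"
    unfolding ext_beta_add_nat_left by simp
  finally show ?thesis .
qed

section \<open>Convergence of the series, and the recurrences before normalisation\<close>

lemma summable_norm_pochhammer_power:
  fixes a z :: complex
  assumes "norm z < 1"
  shows "summable (\<lambda>m. norm (pochhammer a m * (z ^ m / fact m)))"
proof -
  \<comment> \<open>Up to the sign \<open>(-1) ^ m\<close>, \<open>pochhammer a m / fact m\<close>
    is the binomial coefficient of exponent \<open>- a\<close>. The binomial series converges at
    \<open>r\<close>, and the strict gap to \<open>norm z\<close> upgrades this to absolute
    convergence at \<open>- z\<close>, whose sign absorbs the \<open>(-1) ^ m\<close>.\<close>
  obtain r where r: "norm z < r" "r < 1"
    using assms dense by blast
  then have "0 < r"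
    using norm_ge_zero[of z] by linarith
  then have "summable (\<lambda>m. (- a gchoose m) * (of_real r :: complex) ^ m)"
    using r gen_binomial_complex[of "of_real r" "- a"] by (auto intro: sums_summable)
  then have "summable (\<lambda>m. norm ((- a gchoose m) * (- z) ^ m))"
    by (rule powser_insidea) (use r \<open>0 < r\<close> in simp)
  moreover have "norm ((- a gchoose m) * (- z) ^ m) = norm (pochhammer a m * (z ^ m / fact m))" for m
    by (simp add: gbinomial_pochhammer norm_mult norm_divide norm_power)
  ultimately show ?thesis
    by simp
qed

text \<open>
  Without the Beta factor, whose value differs between the terms of the recurrences; the
  parameter \<open>\<beta>\<close> is the exponent \<open>\<beta>\<^sub>1 - \<alpha>\<^sub>2\<close> in place of \<open>\<beta>\<^sub>1\<close>.
\<close>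

definition ext_2F1_sum ::
  "(complex \<Rightarrow> complex) \<Rightarrow> complex \<Rightarrow> complex \<Rightarrow> complex \<Rightarrow> complex \<Rightarrow> complex \<Rightarrow> complex \<Rightarrow> complex"
where
  "ext_2F1_sum \<Theta> a \<alpha> \<beta> z b d =
     (\<Sum>m. pochhammer a m * ext_beta \<Theta> b d (\<alpha> + of_nat m) \<beta> * (z ^ m / fact m))"

lemma summable_ext_2F1_sum:
  assumes "ext_beta_converges \<Theta> b d \<alpha> \<beta>" "norm z < 1"
  shows "summable (\<lambda>m. pochhammer a m * ext_beta \<Theta> b d (\<alpha> + of_nat m) \<beta> * (z ^ m / fact m))"
proof -
  let ?C = "LINT t:{0<..<1}|lborel. norm (ext_beta_integrand \<Theta> b d \<alpha> \<beta> t)"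
  have "summable (\<lambda>m. ?C * norm (pochhammer a m * (z ^ m / fact m)))"
    by (intro summable_mult summable_norm_pochhammer_power assms)
  moreover have "norm (pochhammer a m * ext_beta \<Theta> b d (\<alpha> + of_nat m) \<beta> * (z ^ m / fact m))
      \<le> ?C * norm (pochhammer a m * (z ^ m / fact m))" for m
  proof -
    have "norm (pochhammer a m * ext_beta \<Theta> b d (\<alpha> + of_nat m) \<beta> * (z ^ m / fact m)) =
        norm (ext_beta \<Theta> b d (\<alpha> + of_nat m) \<beta>) * norm (pochhammer a m * (z ^ m / fact m))"
      by (simp add: norm_mult norm_divide)
    then show ?thesis
      using norm_ext_beta_add_nat_le[OF assms(1)] by (simp add: mult_right_mono)
  qed
  ultimately show ?thesis
    by (rule summable_comparison_test'[where N = 0])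
qed

text \<open>Summability justifies moving the constant Beta factor out of the series.\<close>

lemma ext_2F1_eq_sum:
  assumes "ext_beta_converges \<Theta> b d \<alpha> (\<gamma> - \<alpha>)" "norm z < 1"
  shows "ext_2F1 \<Theta> a \<alpha> \<gamma> z b d = ext_2F1_sum \<Theta> a \<alpha> (\<gamma> - \<alpha>) z b d / Beta \<alpha> (\<gamma> - \<alpha>)"
  unfolding ext_2F1_def ext_2F1_sum_def
  by (subst suminf_divide[OF summable_ext_2F1_sum[OF assms], symmetric]) (simp add: mult_ac)

text \<open>Both symbols contain the factor \<open>pochhammer (a + 1) m\<close>; the remaining
  factors \<open>a + 1 + m\<close> and \<open>a\<close> differ by \<open>m + 1\<close>.\<close>

lemma pochhammer_plus1_diff:
  fixes a :: "'a :: comm_ring_1"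
  shows "pochhammer (a + 1) (Suc m) - pochhammer a (Suc m) = of_nat (Suc m) * pochhammer (a + 1) m"
  by (subst pochhammer_rec[of a], subst pochhammer_Suc) (simp add: algebra_simps)

lemma ext_2F1_sum_plus1:
  assumes "ext_beta_converges \<Theta> b d \<alpha> \<beta>" "norm z < 1"
  shows "ext_2F1_sum \<Theta> (a + 1) \<alpha> \<beta> z b d =
           ext_2F1_sum \<Theta> a \<alpha> \<beta> z b d + z * ext_2F1_sum \<Theta> (a + 1) (\<alpha> + 1) \<beta> z b d"
proof -
  define T where "T = (\<lambda>a \<alpha> m. pochhammer a m * ext_beta \<Theta> b d (\<alpha> + of_nat m) \<beta> * (z ^ m / fact m))"
  have "ext_beta_converges \<Theta> b d (\<alpha> + 1) \<beta>"
    using ext_beta_converges_add_nat[OF assms(1), of 1 0] by simp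
  then have summable: "summable (T a \<alpha>)" "summable (T a (\<alpha> + 1))" for a
    unfolding T_def using assms by (simp_all only: summable_ext_2F1_sum)
  have shift: "T (a + 1) \<alpha> (Suc m) - T a \<alpha> (Suc m) = z * T (a + 1) (\<alpha> + 1) m" for m
  proof -
    have "T (a + 1) \<alpha> (Suc m) - T a \<alpha> (Suc m) =
        (pochhammer (a + 1) (Suc m) - pochhammer a (Suc m)) *
        ext_beta \<Theta> b d (\<alpha> + 1 + of_nat m) \<beta> * (z ^ Suc m / fact (Suc m))"
      unfolding T_def by (simp add: algebra_simps)
    \<comment> \<open>The factor \<open>of_nat (Suc m)\<close> cancels against
      \<open>fact (Suc m)\<close> to leave \<open>fact m\<close>, and one power of \<open>z\<close>
      splits off.\<close>
    also have "\<dots> = z * T (a + 1) (\<alpha> + 1) m"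
      unfolding pochhammer_plus1_diff T_def by (simp add: field_simps del: of_nat_Suc)
    finally show ?thesis .
  qed
  have "suminf (T (a + 1) \<alpha>) - suminf (T a \<alpha>) = (\<Sum>m. T (a + 1) \<alpha> m - T a \<alpha> m)"
    by (rule suminf_diff) (rule summable)+
  \<comment> \<open>The terms at \<open>m = 0\<close> cancel, since neither depends on the first
    parameter.\<close>
  also have "\<dots> = (\<Sum>m. T (a + 1) \<alpha> (Suc m) - T a \<alpha> (Suc m))"
    using suminf_split_head[of "\<lambda>m. T (a + 1) \<alpha> m - T a \<alpha> m"] summable_diff[OF summable(1) summable(1)]
    by (simp add: T_def)
  also have "\<dots> = z * suminf (T (a + 1) (\<alpha> + 1))"
    unfolding shift by (rule suminf_mult) (rule summable)
  finally show ?thesis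
    by (simp add: T_def ext_2F1_sum_def algebra_simps)
qed

lemma ext_2F1_sum_binomial:
  assumes "ext_beta_converges \<Theta> b d \<alpha> \<beta>" "norm z < 1"
  shows "ext_2F1_sum \<Theta> a \<alpha> (\<beta> + of_nat n) z b d =
           (\<Sum>k=0..n. (-1) ^ k * of_nat (n choose k) *
              ext_2F1_sum \<Theta> a (\<alpha> + of_nat k) \<beta> z b d)"
proof -
  define T where "T = (\<lambda>k m. pochhammer a m * ext_beta \<Theta> b d (\<alpha> + of_nat k + of_nat m) \<beta> *
    (z ^ m / fact m))"
  have conv: "ext_beta_converges \<Theta> b d (\<alpha> + of_nat k) \<beta>" for k
    using ext_beta_converges_add_nat[OF assms(1), of k 0] by simp
  have summable: "summable (T k)" for k
    unfolding T_def using conv assms(2) by (rule summable_ext_2F1_sum)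
  \<comment> \<open>The binomial expansion is applied at first exponent
    \<open>\<alpha> + of_nat m\<close>; the shifts by \<open>m\<close> and \<open>k\<close> commute,
    so regrouping by \<open>k\<close> gives the series at
    \<open>\<alpha> + of_nat k\<close>.\<close>
  have "pochhammer a m * ext_beta \<Theta> b d (\<alpha> + of_nat m) (\<beta> + of_nat n) * (z ^ m / fact m) =
      (\<Sum>k=0..n. (-1) ^ k * of_nat (n choose k) * T k m)" for m
    unfolding ext_beta_binomial[OF conv] T_def
    by (simp add: sum_distrib_left sum_distrib_right mult_ac add_ac)
  then have "ext_2F1_sum \<Theta> a \<alpha> (\<beta> + of_nat n) z b d =
      (\<Sum>m. \<Sum>k=0..n. (-1) ^ k * of_nat (n choose k) * T k m)"
    by (simp add: ext_2F1_sum_def)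
  also have "\<dots> = (\<Sum>k=0..n. \<Sum>m. (-1) ^ k * of_nat (n choose k) * T k m)"
    by (rule suminf_sum) (intro summable_mult summable)
  also have "\<dots> = (\<Sum>k=0..n. (-1) ^ k * of_nat (n choose k) * suminf (T k))"
    by (intro sum.cong refl suminf_mult summable)
  finally show ?thesis
    by (simp add: T_def ext_2F1_sum_def)
qed

section \<open>Nonvanishing and shift formulas for the normalising Beta factor\<close>

lemma not_nonpos_Int_if_Re_pos:
  "Re x > 0 \<Longrightarrow> x \<notin> \<int>\<^sub>\<le>\<^sub>0"
  by (auto elim!: nonpos_Ints_cases)

lemma pochhammer_nonzero_if_Re_pos:
  "Re x > 0 \<Longrightarrow> pochhammer x n \<noteq> 0"
  using not_nonpos_Int_if_Re_pos[of x] by (auto simp: pochhammer_eq_0_iff)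

lemma Beta_nonzero_if_Re_pos:
  fixes x y :: complex
  assumes "Re x > 0" "Re y > 0"
  shows "Beta x y \<noteq> 0"
  using assms not_nonpos_Int_if_Re_pos[of x] not_nonpos_Int_if_Re_pos[of y]
    not_nonpos_Int_if_Re_pos[of "x + y"]
  by (simp add: Beta_def Gamma_eq_zero_iff)

text \<open>The shift moves one Gamma argument in the numerator and one in the denominator, each
  contributing a Pochhammer symbol. Such quotients produce all Pochhammer coefficients of the
  normalised recurrences.\<close>

lemma Beta_add_nat_left:
  fixes x y :: complex
  assumes "Re x > 0" "Re y > 0"
  shows "Beta (x + of_nat k) y = pochhammer x k / pochhammer (x + y) k * Beta x y"
proof -
  have "x \<notin> \<int>\<^sub>\<le>\<^sub>0" "x + y \<notin> \<int>\<^sub>\<le>\<^sub>0"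
    using assms by (auto intro!: not_nonpos_Int_if_Re_pos)
  then have "pochhammer x k = Gamma (x + of_nat k) / Gamma x"
    "pochhammer (x + y) k = Gamma (x + y + of_nat k) / Gamma (x + y)"
    "Gamma x \<noteq> 0" "Gamma (x + y) \<noteq> 0"
    by (auto intro!: pochhammer_Gamma simp: Gamma_eq_zero_iff)
  then show ?thesis
    by (simp add: Beta_def add_ac)
qed

lemma Beta_add_nat_right:
  fixes x y :: complex
  assumes "Re x > 0" "Re y > 0"
  shows "Beta x (y + of_nat k) = pochhammer y k / pochhammer (x + y) k * Beta x y"
  using Beta_add_nat_left[OF assms(2,1)] by (simp only: Beta_commute[of x] add.commute[of x])

section \<open>Recurrences for the normalised function\<close>

lemma ext_2F1_plus1:
  assumes "ext_2F1_conditions \<Theta> \<alpha> \<gamma> z b d"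
  shows "ext_2F1 \<Theta> (a + 1) \<alpha> \<gamma> z b d =
           ext_2F1 \<Theta> a \<alpha> \<gamma> z b d + \<alpha> * z / \<gamma> * ext_2F1 \<Theta> (a + 1) (\<alpha> + 1) (\<gamma> + 1) z b d"
proof -
  have z: "norm z < 1" and re: "Re \<alpha> > 0" "Re (\<gamma> - \<alpha>) > 0"
    and conv: "ext_beta_converges \<Theta> b d \<alpha> (\<gamma> - \<alpha>)"
    using assms by (auto simp: ext_2F1_conditions_def)
  \<comment> \<open>Raising both parameters by 1 preserves their difference, so only the first beta
    exponent moves.\<close>
  have conv1: "ext_beta_converges \<Theta> b d (\<alpha> + 1) (\<gamma> + 1 - (\<alpha> + 1))"
    using ext_beta_converges_add_nat[OF conv, of 1 0] by simp
  have "\<alpha> \<noteq> 0" "\<gamma> \<noteq> 0"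
    using re by auto
  \<comment> \<open>The normaliser of the shifted function is \<open>\<alpha> / \<gamma>\<close>
    times the original one; the coefficient \<open>\<alpha> * z / \<gamma>\<close> compensates for
    this.\<close>
  moreover have "ext_2F1 \<Theta> (a + 1) (\<alpha> + 1) (\<gamma> + 1) z b d =
      ext_2F1_sum \<Theta> (a + 1) (\<alpha> + 1) (\<gamma> - \<alpha>) z b d / (\<alpha> / \<gamma> * Beta \<alpha> (\<gamma> - \<alpha>))"
    using Beta_add_nat_left[OF re, of 1] ext_2F1_eq_sum[OF conv1 z] by simp
  ultimately show ?thesis
    using Beta_nonzero_if_Re_pos[OF re]
    by (simp add: ext_2F1_eq_sum[OF conv z] ext_2F1_sum_plus1[OF conv z] add_divide_distrib)
qed

text \<open>Iterates the unit step. As \<open>a\<close> is arbitrary, the downward recurrence also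
  follows, by starting at \<open>a - of_nat n\<close>.\<close>

lemma ext_2F1_add_nat:
  assumes "ext_2F1_conditions \<Theta> \<alpha> \<gamma> z b d"
  shows "ext_2F1 \<Theta> (a + of_nat n) \<alpha> \<gamma> z b d =
           ext_2F1 \<Theta> a \<alpha> \<gamma> z b d +
           \<alpha> * z / \<gamma> * (\<Sum>k=1..n. ext_2F1 \<Theta> (a + of_nat k) (\<alpha> + 1) (\<gamma> + 1) z b d)"
proof (induction n)
  case (Suc n)
  then show ?case
    using ext_2F1_plus1[OF assms, of "a + of_nat n"] by (simp add: algebra_simps)
qed simp

text \<open>Raising \<open>\<gamma>\<close> alone by \<open>n\<close> raises the second beta
  exponent by \<open>n\<close>, which \<open>ext_2F1_sum_binomial\<close> expands. The Beta shift on
  the right gives the prefactor, the one on the left the weights inside the sum.\<close>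

lemma ext_2F1_lower_binomial:
  assumes "ext_2F1_conditions \<Theta> \<alpha> \<gamma> z b d"
  shows "ext_2F1 \<Theta> a \<alpha> (\<gamma> + of_nat n) z b d =
           pochhammer \<gamma> n / pochhammer (\<gamma> - \<alpha>) n *
           (\<Sum>k=0..n. (-1) ^ k * of_nat (n choose k) * (pochhammer \<alpha> k / pochhammer \<gamma> k) *
              ext_2F1 \<Theta> a (\<alpha> + of_nat k) (\<gamma> + of_nat k) z b d)"
proof -
  have z: "norm z < 1" and re: "Re \<alpha> > 0" "Re (\<gamma> - \<alpha>) > 0" "Re \<gamma> > 0"
    and conv: "ext_beta_converges \<Theta> b d \<alpha> (\<gamma> - \<alpha>)"
    using assms by (auto simp: ext_2F1_conditions_def)
  have conv': "ext_beta_converges \<Theta> b d \<alpha> (\<gamma> + of_nat n - \<alpha>)"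
    using ext_beta_converges_add_nat[OF conv, of 0 n] by (simp add: algebra_simps)
  have convk: "ext_beta_converges \<Theta> b d (\<alpha> + of_nat k) (\<gamma> + of_nat k - (\<alpha> + of_nat k))" for k
    using ext_beta_converges_add_nat[OF conv, of k 0] by simp
  have nz: "Beta \<alpha> (\<gamma> - \<alpha>) \<noteq> 0" "pochhammer \<alpha> k \<noteq> 0" "pochhammer \<gamma> k \<noteq> 0"
    "pochhammer (\<gamma> - \<alpha>) k \<noteq> 0" for k
    using Beta_nonzero_if_Re_pos[OF re(1,2)] re[THEN pochhammer_nonzero_if_Re_pos] by auto
  \<comment> \<open>The weight cancels the \<open>k\<close>-dependent part of the normaliser, so all
    summands share the denominator \<open>Beta \<alpha> (\<gamma> - \<alpha>)\<close>.\<close>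
  have summand: "pochhammer \<alpha> k / pochhammer \<gamma> k * ext_2F1 \<Theta> a (\<alpha> + of_nat k) (\<gamma> + of_nat k) z b d =
      ext_2F1_sum \<Theta> a (\<alpha> + of_nat k) (\<gamma> - \<alpha>) z b d / Beta \<alpha> (\<gamma> - \<alpha>)" for k
    using nz by (simp add: ext_2F1_eq_sum[OF convk z] Beta_add_nat_left[OF re(1,2)])
  have "ext_2F1 \<Theta> a \<alpha> (\<gamma> + of_nat n) z b d =
      ext_2F1_sum \<Theta> a \<alpha> (\<gamma> - \<alpha> + of_nat n) z b d / Beta \<alpha> (\<gamma> - \<alpha> + of_nat n)"
    by (simp add: ext_2F1_eq_sum[OF conv' z] algebra_simps)
  also have "\<dots> = pochhammer \<gamma> n / pochhammer (\<gamma> - \<alpha>) n *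
      (ext_2F1_sum \<Theta> a \<alpha> (\<gamma> - \<alpha> + of_nat n) z b d / Beta \<alpha> (\<gamma> - \<alpha>))"
    using nz by (simp add: Beta_add_nat_right[OF re(1,2)])
  also have "ext_2F1_sum \<Theta> a \<alpha> (\<gamma> - \<alpha> + of_nat n) z b d / Beta \<alpha> (\<gamma> - \<alpha>) =
      (\<Sum>k=0..n. (-1) ^ k * of_nat (n choose k) *
        (pochhammer \<alpha> k / pochhammer \<gamma> k * ext_2F1 \<Theta> a (\<alpha> + of_nat k) (\<gamma> + of_nat k) z b d))"
    unfolding summand ext_2F1_sum_binomial[OF conv z] by (simp add: sum_divide_distrib)
  finally show ?thesis
    by (simp add: mult_ac)
qed

text \<open>The binomial coefficient formula solved for the Pochhammer symbol, using that
  \<open>(-1) ^ k\<close> is its own inverse. It turns alternating binomial weights into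
  \<open>pochhammer (- of_nat n) i / fact i\<close>.\<close>

lemma pochhammer_minus_nat_eq_binomial:
  "pochhammer (- of_nat n) k = ((-1) ^ k * of_nat (n choose k) * fact k :: 'a :: field_char_0)"
proof -
  have "(of_nat (n choose k) :: 'a) = (-1) ^ k * pochhammer (- of_nat n) k / fact k"
    by (simp add: binomial_gbinomial gbinomial_pochhammer)
  then show ?thesis
    by (simp add: flip: power_mult_distrib)
qed

section \<open>Reindexing and regrouping into the final form of the recurrences\<close>

theorem theorem2p7:
  fixes \<Theta> :: "complex \<Rightarrow> complex" and \<kappa> :: "nat \<Rightarrow> complex"
    and R M\<^sub>0 :: real and \<omega> \<alpha>\<^sub>1 \<alpha>\<^sub>2 \<beta>\<^sub>1 z b d :: complex and n :: nat
  assumes "is_kernel \<kappa> R M\<^sub>0 \<omega> \<Theta>"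
    and "norm z < 1"
  shows
    "(ext_2F1_conditions \<Theta> \<alpha>\<^sub>2 \<beta>\<^sub>1 z b d \<and>
      ext_2F1_conditions \<Theta> (\<alpha>\<^sub>2 + 1) (\<beta>\<^sub>1 + 1) z b d \<longrightarrow>
        ext_2F1 \<Theta> (\<alpha>\<^sub>1 + of_nat n) \<alpha>\<^sub>2 \<beta>\<^sub>1 z b d =
          ext_2F1 \<Theta> \<alpha>\<^sub>1 \<alpha>\<^sub>2 \<beta>\<^sub>1 z b d +
          \<alpha>\<^sub>2 * z / \<beta>\<^sub>1 *
            (\<Sum>k=1..n. ext_2F1 \<Theta> (\<alpha>\<^sub>1 + of_nat n - of_nat k + 1) (\<alpha>\<^sub>2 + 1) (\<beta>\<^sub>1 + 1) z b d) \<and>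
        ext_2F1 \<Theta> (\<alpha>\<^sub>1 - of_nat n) \<alpha>\<^sub>2 \<beta>\<^sub>1 z b d =
          ext_2F1 \<Theta> \<alpha>\<^sub>1 \<alpha>\<^sub>2 \<beta>\<^sub>1 z b d -
          \<alpha>\<^sub>2 * z / \<beta>\<^sub>1 *
            (\<Sum>k=1..n. ext_2F1 \<Theta> (\<alpha>\<^sub>1 - of_nat k + 1) (\<alpha>\<^sub>2 + 1) (\<beta>\<^sub>1 + 1) z b d)) \<and>
     (ext_2F1_conditions \<Theta> \<alpha>\<^sub>2 (\<beta>\<^sub>1 + of_nat n) z b d \<and>
      (\<forall>k\<in>{0..n}. ext_2F1_conditions \<Theta> (\<alpha>\<^sub>2 + of_nat k) (\<beta>\<^sub>1 + of_nat k) z b d) \<longrightarrow>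
        ext_2F1 \<Theta> \<alpha>\<^sub>1 \<alpha>\<^sub>2 (\<beta>\<^sub>1 + of_nat n) z b d =
          pochhammer \<beta>\<^sub>1 n / pochhammer (\<beta>\<^sub>1 - \<alpha>\<^sub>2) n *
            (\<Sum>k=0..n. (-1) ^ k * of_nat (n choose k) *
               (pochhammer \<alpha>\<^sub>2 k / pochhammer \<beta>\<^sub>1 k) *
               ext_2F1 \<Theta> \<alpha>\<^sub>1 (\<alpha>\<^sub>2 + of_nat k) (\<beta>\<^sub>1 + of_nat k) z b d)) \<and>
     (\<alpha>\<^sub>2 \<notin> \<int>\<^sub>\<le>\<^sub>0 \<and> \<beta>\<^sub>1 \<notin> \<int>\<^sub>\<le>\<^sub>0 \<and>
      ext_2F1_conditions \<Theta> (\<alpha>\<^sub>2 + of_nat n) (\<beta>\<^sub>1 + of_nat (2 * n)) z b d \<and>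
      (\<forall>i\<in>{0..n}. ext_2F1_conditions \<Theta> (\<alpha>\<^sub>2 + of_nat (i + n)) (\<beta>\<^sub>1 + of_nat (i + n)) z b d) \<longrightarrow>
        ext_2F1 \<Theta> \<alpha>\<^sub>1 (\<alpha>\<^sub>2 + of_nat n) (\<beta>\<^sub>1 + of_nat (2 * n)) z b d =
          pochhammer \<beta>\<^sub>1 (2 * n) / (pochhammer (\<beta>\<^sub>1 - \<alpha>\<^sub>2) n * pochhammer \<alpha>\<^sub>2 n) *
            (\<Sum>i=0..n. pochhammer (- of_nat n) i *
               (pochhammer \<alpha>\<^sub>2 (i + n) / (pochhammer \<beta>\<^sub>1 (i + n) * fact i)) *
               ext_2F1 \<Theta> \<alpha>\<^sub>1 (\<alpha>\<^sub>2 + of_nat (i + n)) (\<beta>\<^sub>1 + of_nat (i + n)) z b d))"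
proof (intro conjI impI; (elim conjE)?)
  assume cond: "ext_2F1_conditions \<Theta> \<alpha>\<^sub>2 \<beta>\<^sub>1 z b d"
  let ?F = "\<lambda>a. ext_2F1 \<Theta> a (\<alpha>\<^sub>2 + 1) (\<beta>\<^sub>1 + 1) z b d"
  \<comment> \<open>The reflection \<open>k \<mapsto> n + 1 - k\<close> of \<open>{1..n}\<close>
    reverses the order of summation.\<close>
  have "(\<Sum>k=1..n. ?F (\<alpha>\<^sub>1 + of_nat k)) = (\<Sum>k=1..n. ?F (\<alpha>\<^sub>1 + of_nat n - of_nat k + 1))"
    by (rule sum.reindex_bij_witness[of _ "\<lambda>k. n + 1 - k" "\<lambda>k. n + 1 - k"])
       (auto simp: of_nat_diff algebra_simps)
  then show "ext_2F1 \<Theta> (\<alpha>\<^sub>1 + of_nat n) \<alpha>\<^sub>2 \<beta>\<^sub>1 z b d =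
      ext_2F1 \<Theta> \<alpha>\<^sub>1 \<alpha>\<^sub>2 \<beta>\<^sub>1 z b d +
      \<alpha>\<^sub>2 * z / \<beta>\<^sub>1 * (\<Sum>k=1..n. ?F (\<alpha>\<^sub>1 + of_nat n - of_nat k + 1))"
    using ext_2F1_add_nat[OF cond] by simp
  \<comment> \<open>The same reflection, now for the upward recurrence started at
    \<open>\<alpha>\<^sub>1 - of_nat n\<close> and ending at \<open>\<alpha>\<^sub>1\<close>;
    solving for the starting value gives the minus sign.\<close>
  have "(\<Sum>k=1..n. ?F (\<alpha>\<^sub>1 - of_nat n + of_nat k)) = (\<Sum>k=1..n. ?F (\<alpha>\<^sub>1 - of_nat k + 1))"
    by (rule sum.reindex_bij_witness[of _ "\<lambda>k. n + 1 - k" "\<lambda>k. n + 1 - k"])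
       (auto simp: of_nat_diff algebra_simps)
  then show "ext_2F1 \<Theta> (\<alpha>\<^sub>1 - of_nat n) \<alpha>\<^sub>2 \<beta>\<^sub>1 z b d =
      ext_2F1 \<Theta> \<alpha>\<^sub>1 \<alpha>\<^sub>2 \<beta>\<^sub>1 z b d -
      \<alpha>\<^sub>2 * z / \<beta>\<^sub>1 * (\<Sum>k=1..n. ?F (\<alpha>\<^sub>1 - of_nat k + 1))"
    using ext_2F1_add_nat[OF cond, of "\<alpha>\<^sub>1 - of_nat n" n] by simp
next
  assume "\<forall>k\<in>{0..n}. ext_2F1_conditions \<Theta> (\<alpha>\<^sub>2 + of_nat k) (\<beta>\<^sub>1 + of_nat k) z b d"
  then have "ext_2F1_conditions \<Theta> (\<alpha>\<^sub>2 + of_nat 0) (\<beta>\<^sub>1 + of_nat 0) z b d"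
    by (rule bspec) simp
  then show "ext_2F1 \<Theta> \<alpha>\<^sub>1 \<alpha>\<^sub>2 (\<beta>\<^sub>1 + of_nat n) z b d =
      pochhammer \<beta>\<^sub>1 n / pochhammer (\<beta>\<^sub>1 - \<alpha>\<^sub>2) n *
      (\<Sum>k=0..n. (-1) ^ k * of_nat (n choose k) * (pochhammer \<alpha>\<^sub>2 k / pochhammer \<beta>\<^sub>1 k) *
         ext_2F1 \<Theta> \<alpha>\<^sub>1 (\<alpha>\<^sub>2 + of_nat k) (\<beta>\<^sub>1 + of_nat k) z b d)"
    by (intro ext_2F1_lower_binomial) simp
next
  assume "\<alpha>\<^sub>2 \<notin> \<int>\<^sub>\<le>\<^sub>0" "\<beta>\<^sub>1 \<notin> \<int>\<^sub>\<le>\<^sub>0"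
  \<comment> \<open>Only \<open>\<alpha>\<^sub>2 + of_nat n\<close> and
    \<open>\<beta>\<^sub>1 + of_nat n\<close> are known to have positive real part, so nonvanishing
    at the unshifted parameters comes from excluding the poles of Gamma.\<close>
  then have nz: "pochhammer \<alpha>\<^sub>2 k \<noteq> 0" "pochhammer \<beta>\<^sub>1 k \<noteq> 0" for k
    by (auto simp: pochhammer_eq_0_iff)
  assume "\<forall>i\<in>{0..n}. ext_2F1_conditions \<Theta> (\<alpha>\<^sub>2 + of_nat (i + n)) (\<beta>\<^sub>1 + of_nat (i + n)) z b d"
  \<comment> \<open>The instance \<open>i = 0\<close> is the base point for
    \<open>ext_2F1_lower_binomial\<close>; the difference of its parameters is still
    \<open>\<beta>\<^sub>1 - \<alpha>\<^sub>2\<close>.\<close>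
  then have "ext_2F1_conditions \<Theta> (\<alpha>\<^sub>2 + of_nat (0 + n)) (\<beta>\<^sub>1 + of_nat (0 + n)) z b d"
    by (rule bspec) simp
  then have cond: "ext_2F1_conditions \<Theta> (\<alpha>\<^sub>2 + of_nat n) (\<beta>\<^sub>1 + of_nat n) z b d"
    by simp
  let ?F = "\<lambda>i. ext_2F1 \<Theta> \<alpha>\<^sub>1 (\<alpha>\<^sub>2 + of_nat (i + n)) (\<beta>\<^sub>1 + of_nat (i + n)) z b d"
  have split: "pochhammer x (k + n) = pochhammer x n * pochhammer (x + of_nat n) k"
    for x :: complex and k
    using pochhammer_product'[of x n k] by (simp add: add_ac)
  \<comment> \<open>Splitting the symbols of length \<open>i + n\<close> returns the shifted symbols
    to base \<open>\<alpha>\<^sub>2\<close> and \<open>\<beta>\<^sub>1\<close>, at the price of a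
    constant independent of \<open>i\<close>.\<close>
  have summand: "(-1) ^ i * of_nat (n choose i) *
      (pochhammer (\<alpha>\<^sub>2 + of_nat n) i / pochhammer (\<beta>\<^sub>1 + of_nat n) i) * ?F i =
      pochhammer \<beta>\<^sub>1 n / pochhammer \<alpha>\<^sub>2 n * (pochhammer (- of_nat n) i *
        (pochhammer \<alpha>\<^sub>2 (i + n) / (pochhammer \<beta>\<^sub>1 (i + n) * fact i)) * ?F i)" for i
    using nz by (simp add: split pochhammer_minus_nat_eq_binomial)
  have "ext_2F1 \<Theta> \<alpha>\<^sub>1 (\<alpha>\<^sub>2 + of_nat n) (\<beta>\<^sub>1 + of_nat (2 * n)) z b d =
      ext_2F1 \<Theta> \<alpha>\<^sub>1 (\<alpha>\<^sub>2 + of_nat n) (\<beta>\<^sub>1 + of_nat n + of_nat n) z b d"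
    by (simp add: add.assoc)
  also have "\<dots> = pochhammer (\<beta>\<^sub>1 + of_nat n) n / pochhammer (\<beta>\<^sub>1 - \<alpha>\<^sub>2) n *
      (\<Sum>i=0..n. (-1) ^ i * of_nat (n choose i) *
        (pochhammer (\<alpha>\<^sub>2 + of_nat n) i / pochhammer (\<beta>\<^sub>1 + of_nat n) i) * ?F i)"
    using ext_2F1_lower_binomial[OF cond, of \<alpha>\<^sub>1 n] by (simp add: add_ac)
  also have "\<dots> = pochhammer (\<beta>\<^sub>1 + of_nat n) n / pochhammer (\<beta>\<^sub>1 - \<alpha>\<^sub>2) n *
      (pochhammer \<beta>\<^sub>1 n / pochhammer \<alpha>\<^sub>2 n * (\<Sum>i=0..n. pochhammer (- of_nat n) i *
        (pochhammer \<alpha>\<^sub>2 (i + n) / (pochhammer \<beta>\<^sub>1 (i + n) * fact i)) * ?F i))"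
    unfolding summand sum_distrib_left ..
  \<comment> \<open>That constant's numerator \<open>pochhammer \<beta>\<^sub>1 n\<close> merges
    with \<open>pochhammer (\<beta>\<^sub>1 + of_nat n) n\<close> into a symbol of length
    \<open>2 * n\<close>.\<close>
  also have "\<dots> = pochhammer \<beta>\<^sub>1 (2 * n) / (pochhammer (\<beta>\<^sub>1 - \<alpha>\<^sub>2) n * pochhammer \<alpha>\<^sub>2 n) *
      (\<Sum>i=0..n. pochhammer (- of_nat n) i *
        (pochhammer \<alpha>\<^sub>2 (i + n) / (pochhammer \<beta>\<^sub>1 (i + n) * fact i)) * ?F i)"
    unfolding mult_2 split[of \<beta>\<^sub>1 n] by simp
  finally show "ext_2F1 \<Theta> \<alpha>\<^sub>1 (\<alpha>\<^sub>2 + of_nat n) (\<beta>\<^sub>1 + of_nat (2 * n)) z b d =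
      pochhammer \<beta>\<^sub>1 (2 * n) / (pochhammer (\<beta>\<^sub>1 - \<alpha>\<^sub>2) n * pochhammer \<alpha>\<^sub>2 n) *
      (\<Sum>i=0..n. pochhammer (- of_nat n) i *
        (pochhammer \<alpha>\<^sub>2 (i + n) / (pochhammer \<beta>\<^sub>1 (i + n) * fact i)) * ?F i)" .
qed

end
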